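(* Let $(\mathbb S,\oplus,\odot,\mathbf 0,\mathbf 1)$ be a commutative semiring and $d\ge1$. There is an algorithm which, given $T\ge1$, a time series $z=(z_1,\dots,z_T)$ with $z_i\in\mathbb S^d$, and a word $w=w_1\cdots w_k\in A^*$ of length $k\ge1$, calculates $$\big\langle \mathrm{ISS}^{\mathbb S}_{0,T}(z),w\big\rangle$$ with computational cost $O(T\cdot k)$ and storage cost $O(T\cdot k)$.
   Context: A commutative semiring $(\mathbb S,\oplus,\odot,\mathbf 0,\mathbf 1)$ consists of two commutative monoids $(\mathbb S,\oplus,\mathbf 0)$ and $(\mathbb S,\odot,\mathbf 1)$ such that $\odot$ distributes over $\oplus$ and $\mathbf 0\odot s=\mathbf 0$ for all $s$. The alphabet $A$ is the set of all non-constant formal commutative monomials $[a_1\cdots a_m]$ ($m\ge1$, $a_i\in\{1,\dots,d\}$), and $A^*$ is the set of words over $A$. For $z_j=(z_j^{(1)},\dots,z_j^{(d)})\in\mathbb S^d$ and $a=[a_1\cdots a_m]\in A$ put $z_j^{\odot a}:=z_j^{(a_1)}\odot\cdots\odot z_j^{(a_m)}$. For $w=w_1\cdots w_k$ with $w_i\in A$, $$\langle \mathrm{ISS}^{\mathbb S}_{0,T}(z),w\rangle:=\bigoplus_{0<j_1<\cdots<j_k\le T} z_{j_1}^{\odot w_1}\odot\cdots\odot z_{j_k}^{\odot w_k}$$ (an empty sum is $\mathbf 0$). Cost model: computational cost counts semiring operations $\oplus,\odot$ and evaluations of $z_j^{\odot a}$ for a single letter $a\in A$, each at unit cost; storage cost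 counts stored elements of $\mathbb S$. *)

theory Defs
  imports "HOL-Library.Multiset" "HOL-Analysis.Finite_Cartesian_Product"
begin

text \<open>
  A commutative semiring is a type of sort \<open>{comm_semiring_0, comm_monoid_mult}\<close>. This is the
  library class \<open>comm_semiring_1\<close> without the axiom \<open>0 \<noteq> 1\<close>, which is not assumed here.
  The dimension \<open>d\<close> is the cardinality of a finite (hence nonempty) index type \<open>'d\<close>.
\<close>

subsection \<open>Iterated sums\<close>

text \<open>Formal commutative monomials are multisets of coordinates; the constant one is excluded.\<close>

type_synonym 'd letter = "'d multiset"

definition alphabet :: "'d letter set" where
  "alphabet = {a. a \<noteq> {#}}"

definition letter_eval :: "'s::comm_monoid_mult ^ 'd \<Rightarrow> 'd letter \<Rightarrow> 's" where
  "letter_eval v a = (\<Prod>i\<in>#a. v $ i)"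

text \<open>
  \<open>ISS T z w\<close> is the coefficient of the iterated-sums signature over \<open>(0,T]\<close> at the word \<open>w\<close>.
  Only \<open>z 1, \<dots>, z T\<close> matter. A list \<open>js\<close> holds the indices \<open>j\<^sub>1 < \<dots> < j\<^sub>k\<close>, so that
  \<open>js ! p\<close> and \<open>w ! p\<close> are the index and the letter with number \<open>p + 1\<close>.
\<close>

definition ISS ::
  "nat \<Rightarrow> (nat \<Rightarrow> 's::{comm_semiring_0, comm_monoid_mult} ^ 'd) \<Rightarrow> 'd letter list \<Rightarrow> 's" where
  "ISS T z w =
    (\<Sum>js | length js = length w \<and> sorted_wrt (<) js \<and> set js \<subseteq> {1..T}.
       \<Prod>p<length w. letter_eval (z (js ! p)) (w ! p))"

subsection \<open>Algorithms over a semiring\<close>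

text \<open>
  An algorithm is a single while-program, independent of the input. Control flow uses natural
  number variables; it can inspect \<open>T\<close> and the length \<open>k\<close> of the word, but never a semiring
  element. Semiring elements live in cells addressed by natural numbers, are created only by the
  commands below, and each command writes the cell given by its first argument.
  \<open>Eval_Letter a j i\<close> stores \<open>z\<^sub>j\<close> evaluated at the letter \<open>w\<^sub>i\<close>.
\<close>

type_synonym vname = string

datatype iexp =
    Num nat
  | Var vname
  | Series_Length
  | Word_Length
  | Plus iexp iexp
  | Minus iexp iexp
  | Times iexp iexp

datatype bexp = Less iexp iexp | Not bexp | And bexp bexp

datatype com =
    Skip
  | Assign vname iexp
  | Put_Zero iexp
  | Put_One iexp
  | Copy iexp iexp
  | Add iexp iexp iexp
  | Mult iexp iexp iexp
  | Eval_Letter iexp iexp iexp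
  | Seq com com
  | If bexp com com
  | While bexp com

type_synonym istore = "vname \<Rightarrow> nat"
type_synonym 's cells = "nat \<Rightarrow> 's option"

text \<open>The first two arguments are \<open>T\<close> and \<open>k\<close>.\<close>

fun ival :: "nat \<Rightarrow> nat \<Rightarrow> istore \<Rightarrow> iexp \<Rightarrow> nat" where
  "ival T k \<sigma> (Num n) = n"
| "ival T k \<sigma> (Var x) = \<sigma> x"
| "ival T k \<sigma> Series_Length = T"
| "ival T k \<sigma> Word_Length = k"
| "ival T k \<sigma> (Plus e f) = ival T k \<sigma> e + ival T k \<sigma> f"
| "ival T k \<sigma> (Minus e f) = ival T k \<sigma> e - ival T k \<sigma> f"
| "ival T k \<sigma> (Times e f) = ival T k \<sigma> e * ival T k \<sigma> f"

fun bval :: "nat \<Rightarrow> nat \<Rightarrow> istore \<Rightarrow> bexp \<Rightarrow> bool" where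
  "bval T k \<sigma> (Less e f) \<longleftrightarrow> ival T k \<sigma> e < ival T k \<sigma> f"
| "bval T k \<sigma> (Not b) \<longleftrightarrow> \<not> bval T k \<sigma> b"
| "bval T k \<sigma> (And b c) \<longleftrightarrow> bval T k \<sigma> b \<and> bval T k \<sigma> c"

text \<open>
  \<open>exec T z w c (\<sigma>, \<mu>) n (\<sigma>', \<mu>')\<close>: on input \<open>T, z, w\<close> the program \<open>c\<close>, started with index
  variables \<open>\<sigma>\<close> and cells \<open>\<mu>\<close>, terminates with \<open>\<sigma>'\<close> and \<open>\<mu>'\<close> at computational cost \<open>n\<close>.
  Only \<open>Add\<close>, \<open>Mult\<close> and \<open>Eval_Letter\<close> have nonzero cost. There is no execution that reads an
  empty cell, or an entry of the input outside \<open>1 \<le> j \<le> T\<close>, \<open>1 \<le> i \<le> k\<close>.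
\<close>

inductive exec ::
  "nat \<Rightarrow> (nat \<Rightarrow> 's::{comm_semiring_0, comm_monoid_mult} ^ 'd) \<Rightarrow> 'd letter list \<Rightarrow> com \<Rightarrow>
   istore \<times> 's cells \<Rightarrow> nat \<Rightarrow> istore \<times> 's cells \<Rightarrow> bool"
  for T z w where
  exec_Skip: "exec T z w Skip s 0 s"
| exec_Assign:
    "exec T z w (Assign x e) (\<sigma>, \<mu>) 0 (\<sigma>(x := ival T (length w) \<sigma> e), \<mu>)"
| exec_Put_Zero:
    "exec T z w (Put_Zero a) (\<sigma>, \<mu>) 0 (\<sigma>, \<mu>(ival T (length w) \<sigma> a \<mapsto> 0))"
| exec_Put_One:
    "exec T z w (Put_One a) (\<sigma>, \<mu>) 0 (\<sigma>, \<mu>(ival T (length w) \<sigma> a \<mapsto> 1))"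
| exec_Copy:
    "\<mu> (ival T (length w) \<sigma> b) = Some x \<Longrightarrow>
     exec T z w (Copy a b) (\<sigma>, \<mu>) 0 (\<sigma>, \<mu>(ival T (length w) \<sigma> a \<mapsto> x))"
| exec_Add:
    "\<lbrakk>\<mu> (ival T (length w) \<sigma> b) = Some x; \<mu> (ival T (length w) \<sigma> c) = Some y\<rbrakk> \<Longrightarrow>
     exec T z w (Add a b c) (\<sigma>, \<mu>) 1 (\<sigma>, \<mu>(ival T (length w) \<sigma> a \<mapsto> x + y))"
| exec_Mult:
    "\<lbrakk>\<mu> (ival T (length w) \<sigma> b) = Some x; \<mu> (ival T (length w) \<sigma> c) = Some y\<rbrakk> \<Longrightarrow>
     exec T z w (Mult a b c) (\<sigma>, \<mu>) 1 (\<sigma>, \<mu>(ival T (length w) \<sigma> a \<mapsto> x * y))"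
| exec_Eval_Letter:
    "\<lbrakk>ival T (length w) \<sigma> j \<in> {1..T}; ival T (length w) \<sigma> i \<in> {1..length w}\<rbrakk> \<Longrightarrow>
     exec T z w (Eval_Letter a j i) (\<sigma>, \<mu>) 1
       (\<sigma>, \<mu>(ival T (length w) \<sigma> a \<mapsto>
          letter_eval (z (ival T (length w) \<sigma> j)) (w ! (ival T (length w) \<sigma> i - 1))))"
| exec_Seq:
    "\<lbrakk>exec T z w c s m t; exec T z w c' t n u\<rbrakk> \<Longrightarrow> exec T z w (Seq c c') s (m + n) u"
| exec_If_True:
    "\<lbrakk>bval T (length w) (fst s) b; exec T z w c s n t\<rbrakk> \<Longrightarrow> exec T z w (If b c c') s n t"
| exec_If_False:
    "\<lbrakk>\<not> bval T (length w) (fst s) b; exec T z w c' s n t\<rbrakk> \<Longrightarrow> exec T z w (If b c c') s n t"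
| exec_While_False:
    "\<not> bval T (length w) (fst s) b \<Longrightarrow> exec T z w (While b c) s 0 s"
| exec_While_True:
    "\<lbrakk>bval T (length w) (fst s) b; exec T z w c s m t; exec T z w (While b c) t n u\<rbrakk> \<Longrightarrow>
     exec T z w (While b c) s (m + n) u"

inductive_cases exec_SkipE: "exec T z w Skip s n t"
inductive_cases exec_AssignE: "exec T z w (Assign x e) s n t"
inductive_cases exec_Put_ZeroE: "exec T z w (Put_Zero a) s n t"
inductive_cases exec_Put_OneE: "exec T z w (Put_One a) s n t"
inductive_cases exec_CopyE: "exec T z w (Copy a b) s n t"
inductive_cases exec_AddE: "exec T z w (Add a b c) s n t"
inductive_cases exec_MultE: "exec T z w (Mult a b c) s n t"
inductive_cases exec_Eval_LetterE: "exec T z w (Eval_Letter a j i) s n t"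
inductive_cases exec_SeqE: "exec T z w (Seq c c') s n t"
inductive_cases exec_IfE: "exec T z w (If b c c') s n t"
inductive_cases exec_WhileE: "exec T z w (While b c) s n t"

lemma exec_deterministic:
  assumes "exec T z w c s n t" and "exec T z w c s n' t'"
  shows "n' = n \<and> t' = t"
  using assms
proof (induction arbitrary: n' t' rule: exec.induct)
  case (exec_Seq c s m t c' n u)
  from exec_Seq.prems show ?case
    by (rule exec_SeqE) (metis exec_Seq.IH)
next
  case (exec_If_True s b c n t c')
  from exec_If_True.prems show ?case
    by (rule exec_IfE) (metis exec_If_True.IH exec_If_True.hyps(1))+
next
  case (exec_If_False s b c' n t c)
  from exec_If_False.prems show ?case
    by (rule exec_IfE) (metis exec_If_False.IH exec_If_False.hyps(1))+
next
  case (exec_While_False s b c)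
  from exec_While_False.prems show ?case
    by (rule exec_WhileE) (use exec_While_False.hyps in simp_all)
next
  case (exec_While_True s b c m t n u)
  from exec_While_True.prems show ?case
    by (rule exec_WhileE) (metis exec_While_True.IH exec_While_True.hyps(1))+
qed (auto elim!: exec_SkipE exec_AssignE exec_Put_ZeroE exec_Put_OneE exec_CopyE exec_AddE
       exec_MultE exec_Eval_LetterE)

text \<open>
  Cells are never released, so the number of occupied cells in the final state is the largest
  number of semiring elements stored at any time during the run.
\<close>

definition storage :: "istore \<times> 's cells \<Rightarrow> nat" where
  "storage s = card (dom (snd s))"

lemma exec_dom_mono: "exec T z w c s n t \<Longrightarrow> dom (snd s) \<subseteq> dom (snd t)"
  by (induction rule: exec.induct) auto

lemma exec_finite_dom: "exec T z w c s n t \<Longrightarrow> finite (dom (snd s)) \<Longrightarrow> finite (dom (snd t))"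
  by (induction rule: exec.induct) auto

definition init_state :: "istore \<times> 's cells" where
  "init_state = (\<lambda>_. 0, Map.empty)"

text \<open>The result of a program is the content of cell \<open>0\<close> at termination.\<close>

definition result :: "istore \<times> 's cells \<Rightarrow> 's option" where
  "result s = snd s 0"

end

(* The coefficients F j p at the prefixes of length p of w satisfy F j 0 = 1 and
   F (j + 1) (p + 1) = F j (p + 1) + F j p * z_{j+1}^{w_{p+1}}, by splitting off the index tuples
   that end in j + 1. One column F j is kept in memory and updated in place T times, at three
   operations per entry. *)

theory Submission imports Defs begin

section \<open>Index tuples and the recursion for the coefficients\<close>

definition index_lists :: "nat \<Rightarrow> nat \<Rightarrow> nat list set" where
  "index_lists T k = {js. length js = k \<and> sorted_wrt (<) js \<and> set js \<subseteq> {1..T}}"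

lemma finite_index_lists: "finite (index_lists T k)"
  by (rule finite_subset[OF _ finite_lists_length_eq[of "{1..T}" k]]) (auto simp: index_lists_def)

lemma index_lists_0: "index_lists T 0 = {[]}"
  by (auto simp: index_lists_def)

lemma index_lists_0_Suc: "index_lists 0 (Suc k) = {}"
  by (auto simp: index_lists_def)

text \<open>A strictly increasing list has its maximum at the end, so \<open>Suc T\<close> can only
  be the last entry. Deleting it there leaves a shorter list with entries in \<open>{1..T}\<close>;
  a list without it already lies in \<open>{1..T}\<close>.\<close>

lemma index_lists_Suc_Suc:
  "index_lists (Suc T) (Suc k) =
    index_lists T (Suc k) \<union> (\<lambda>js. js @ [Suc T]) ` index_lists T k"
proof (intro equalityI subsetI)
  fix js
  assume js: "js \<in> index_lists (Suc T) (Suc k)"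
  then obtain ls j where eq: "js = ls @ [j]"
    by (cases js rule: rev_cases) (auto simp: index_lists_def)
  have less: "\<And>i. i \<in> set ls \<Longrightarrow> i < j" and j: "1 \<le> j" "j \<le> Suc T"
    and ge: "\<And>i. i \<in> set ls \<Longrightarrow> 1 \<le> i"
    and rest: "length ls = k" "sorted_wrt (<) ls"
    using js eq by (auto simp: index_lists_def sorted_wrt_append)
  show "js \<in> index_lists T (Suc k) \<union> (\<lambda>js. js @ [Suc T]) ` index_lists T k"
  proof (cases "j = Suc T")
    case True
    then have "set ls \<subseteq> {1..T}" using less ge by (auto simp: less_Suc_eq_le)
    then have "ls \<in> index_lists T k" using rest by (simp add: index_lists_def)
    then show ?thesis using eq True by auto
  next
    case False
    then have "j \<le> T" using j by simp
    then have "i \<le> T" if "i \<in> set ls" for i using less[OF that] by simp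
    then have "set js \<subseteq> {1..T}" using ge j \<open>j \<le> T\<close> eq by auto
    then have "js \<in> index_lists T (Suc k)" using js by (simp add: index_lists_def)
    then show ?thesis by simp
  qed
next
  fix js
  assume "js \<in> index_lists T (Suc k) \<union> (\<lambda>js. js @ [Suc T]) ` index_lists T k"
  then show "js \<in> index_lists (Suc T) (Suc k)"
    by (auto simp: index_lists_def sorted_wrt_append subset_iff less_Suc_eq_le le_SucI)
qed

lemma ISS_index_lists:
  "ISS T z w = (\<Sum>js\<in>index_lists T (length w). \<Prod>p<length w. letter_eval (z (js ! p)) (w ! p))"
  by (simp add: ISS_def index_lists_def)

lemma ISS_Nil: "ISS T z [] = 1"
  by (simp add: ISS_index_lists index_lists_0)

lemma ISS_0: "w \<noteq> [] \<Longrightarrow> ISS 0 z w = 0"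
  by (cases w) (simp_all add: ISS_index_lists index_lists_0_Suc)

text \<open>The index lists split into those avoiding \<open>Suc T\<close> and those ending in it,
  which is a disjoint union. In the second part the last factor is the same for every list, so
  distributivity pulls it out of the sum.\<close>

lemma ISS_Suc_snoc:
  "ISS (Suc T) z (w @ [a]) = ISS T z (w @ [a]) + ISS T z w * letter_eval (z (Suc T)) a"
proof -
  let ?k = "length w"
  let ?f = "\<lambda>js. \<Prod>p<Suc ?k. letter_eval (z (js ! p)) ((w @ [a]) ! p)"
  let ?g = "\<lambda>js. \<Prod>p<?k. letter_eval (z (js ! p)) (w ! p)"
  have disj: "index_lists T (Suc ?k) \<inter> (\<lambda>js. js @ [Suc T]) ` index_lists T ?k = {}"
    by (auto simp: index_lists_def)
  have inj: "inj_on (\<lambda>js. js @ [Suc T]) (index_lists T ?k)"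
    by (auto simp: inj_on_def)
  \<comment> \<open>The appended index and the appended letter both sit at position
    \<open>?k\<close>; all earlier positions see only \<open>js\<close> and
    \<open>w\<close>.\<close>
  have f: "?f (js @ [Suc T]) = ?g js * letter_eval (z (Suc T)) a" if "js \<in> index_lists T ?k" for js
  proof -
    have len: "length js = ?k" using that by (simp add: index_lists_def)
    then have "(\<Prod>p<?k. letter_eval (z ((js @ [Suc T]) ! p)) ((w @ [a]) ! p)) = ?g js"
      by (intro prod.cong) (auto simp: nth_append)
    then show ?thesis using len by (simp add: nth_append)
  qed
  have "ISS (Suc T) z (w @ [a]) =
      sum ?f (index_lists T (Suc ?k)) + sum ?f ((\<lambda>js. js @ [Suc T]) ` index_lists T ?k)"
    unfolding ISS_index_lists length_append_singleton index_lists_Suc_Suc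
    by (intro sum.union_disjoint finite_imageI finite_index_lists disj)
  also have "sum ?f ((\<lambda>js. js @ [Suc T]) ` index_lists T ?k) =
      (\<Sum>js\<in>index_lists T ?k. ?g js * letter_eval (z (Suc T)) a)"
    unfolding sum.reindex[OF inj] o_def by (rule sum.cong) (auto simp: f simp del: prod.lessThan_Suc)
  finally show ?thesis
    by (simp add: ISS_index_lists sum_distrib_right del: prod.lessThan_Suc)
qed

text \<open>The recursion never leaves the prefixes of one fixed word, so a column of
  \<open>length w + 1\<close> values is closed under the step from \<open>T\<close> to
  \<open>Suc T\<close>.\<close>

lemma ISS_Suc_take:
  assumes "p < length w"
  shows "ISS (Suc T) z (take (Suc p) w) =
    ISS T z (take (Suc p) w) + ISS T z (take p w) * letter_eval (z (Suc T)) (w ! p)"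
  using assms by (simp add: take_Suc_conv_app_nth ISS_Suc_snoc)

section \<open>Exact cost of counting loops\<close>

lemma exec_counting_loop:
  assumes guard: "\<And>i s. i \<le> N \<Longrightarrow> P i s \<Longrightarrow> bval T (length w) (fst s) b \<longleftrightarrow> i < N"
    and body: "\<And>i s. i < N \<Longrightarrow> P i s \<Longrightarrow> \<exists>t. exec T z w c s m t \<and> P (Suc i) t"
    and init: "P 0 s"
  shows "\<exists>t. exec T z w (While b c) s (N * m) t \<and> P N t"
proof -
  \<comment> \<open>Generalised to a start after \<open>i\<close> completed passes, so that the
    induction can descend from \<open>N\<close>, where the guard fails. Each of the
    \<open>N - i\<close> remaining passes costs \<open>m\<close>.\<close>
  have "\<exists>t. exec T z w (While b c) s ((N - i) * m) t \<and> P N t" if "i \<le> N" "P i s" for i s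
    using that
  proof (induction i arbitrary: s rule: inc_induct)
    case base
    then show ?case using guard[of N s] exec_While_False[of T w s b z c] by (intro exI[of _ s]) simp
  next
    case (step i)
    then obtain t where t: "exec T z w c s m t" "P (Suc i) t" using body by blast
    then obtain u where u: "exec T z w (While b c) t ((N - Suc i) * m) u" "P N u"
      using step.IH by blast
    have "N - i = Suc (N - Suc i)" using step.hyps by arith
    then have "(N - i) * m = m + (N - Suc i) * m" by (metis mult_Suc)
    moreover have "bval T (length w) (fst s) b" using guard[of i s] step.hyps step.prems by simp
    ultimately show ?case using exec_While_True[OF _ t(1) u(1)] u(2) by metis
  qed
  from this[of 0] init show ?thesis by simp
qed

section \<open>The program, with a single column of coefficients in memory\<close>

text \<open>
  Cell \<open>r\<close> holds the coefficient at the prefix of length \<open>k - r\<close>, so that the result ends up in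
  cell \<open>0\<close> and an ascending sweep reads cell \<open>r + 1\<close> before overwriting it. Cell \<open>k + 1\<close> is scratch.
\<close>

definition initialize :: com where
  "initialize =
    Seq (Put_One Word_Length)
      (While (Less (Var ''i'') Word_Length)
        (Seq (Put_Zero (Var ''i'')) (Assign ''i'' (Plus (Var ''i'') (Num 1)))))"

text \<open>The prefix belonging to cell \<open>i\<close> ends in letter number
  \<open>k - i\<close>, counted from 1. The scratch cell holds first the value of this letter, then
  its product with the neighbouring coefficient.\<close>

definition update_cell :: com where
  "update_cell =
    Seq (Eval_Letter (Plus Word_Length (Num 1)) (Var ''j'') (Minus Word_Length (Var ''i'')))
    (Seq (Mult (Plus Word_Length (Num 1)) (Plus (Var ''i'') (Num 1)) (Plus Word_Length (Num 1)))
    (Seq (Add (Var ''i'') (Var ''i'') (Plus Word_Length (Num 1)))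
      (Assign ''i'' (Plus (Var ''i'') (Num 1)))))"

text \<open>The counter \<open>j\<close> starts at 0 while the series starts at 1, hence the
  increment comes first. Cell \<open>k\<close> is left alone: the empty prefix has coefficient 1 at
  all times.\<close>

definition sweep :: com where
  "sweep =
    Seq (Assign ''j'' (Plus (Var ''j'') (Num 1)))
    (Seq (Assign ''i'' (Num 0))
      (While (Less (Var ''i'') Word_Length) update_cell))"

definition iss_program :: com where
  "iss_program = Seq initialize (While (Less (Var ''j'') Series_Length) sweep)"

text \<open>At time 0 there are no indices to choose, so every nonempty prefix has coefficient 0 and
  the empty one has 1. Both counters are already 0 in \<open>init_state\<close>. The bound on the
  domain leaves room for the scratch cell, as the later invariants require.\<close>

lemma exec_initialize:
  fixes z :: "nat \<Rightarrow> 's::{comm_semiring_0, comm_monoid_mult} ^ 'd"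
  shows "\<exists>\<sigma> \<mu>. exec T z w initialize init_state 0 (\<sigma>, \<mu>) \<and> \<sigma> ''j'' = 0 \<and>
     (\<forall>r\<le>length w. \<mu> r = Some (ISS 0 z (take (length w - r) w))) \<and> dom \<mu> \<subseteq> {..Suc (length w)}"
proof -
  let ?k = "length w"
  let ?c = "Seq (Put_Zero (Var ''i'')) (Assign ''i'' (Plus (Var ''i'') (Num 1)))"
  define P where "P i s \<longleftrightarrow> fst s ''i'' = i \<and> fst s ''j'' = 0 \<and>
    snd s ?k = Some 1 \<and> (\<forall>r<i. snd s r = Some 0) \<and> dom (snd s) \<subseteq> {..Suc ?k}"
    for i and s :: "istore \<times> 's cells"
  have "\<exists>t. exec T z w (While (Less (Var ''i'') Word_Length) ?c)
      (\<lambda>_. 0, [?k \<mapsto> 1]) (?k * 0) t \<and> P ?k t"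
  proof (rule exec_counting_loop)
    fix i and s :: "istore \<times> 's cells"
    assume i: "i < ?k" and P: "P i s"
    obtain \<sigma> \<mu> where s: "s = (\<sigma>, \<mu>)" by fastforce
    have "exec T z w ?c s (0 + 0) (\<sigma>(''i'' := Suc i), \<mu>(i \<mapsto> 0))"
      unfolding s
      using P s exec_Put_Zero[of T z w "Var ''i''" \<sigma> \<mu>]
        exec_Assign[of T z w "''i''" "Plus (Var ''i'') (Num 1)" \<sigma> "\<mu>(i \<mapsto> 0)"]
      by (intro exec_Seq) (auto simp: P_def)
    moreover have "P (Suc i) (\<sigma>(''i'' := Suc i), \<mu>(i \<mapsto> 0))"
      using P s i by (auto simp: P_def)
    ultimately show "\<exists>t. exec T z w ?c s 0 t \<and> P (Suc i) t" by auto
  qed (auto simp: P_def split: if_splits)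
  then obtain \<sigma> \<mu> where
    loop: "exec T z w (While (Less (Var ''i'') Word_Length) ?c) (\<lambda>_. 0, [?k \<mapsto> 1]) 0 (\<sigma>, \<mu>)"
    and P: "P ?k (\<sigma>, \<mu>)" by auto
  have "exec T z w (Put_One Word_Length) init_state 0 (\<lambda>_. 0, [?k \<mapsto> 1])"
    using exec_Put_One[of T z w Word_Length "\<lambda>_. 0" Map.empty] by (simp add: init_state_def)
  from exec_Seq[OF this loop] have "exec T z w initialize init_state 0 (\<sigma>, \<mu>)"
    by (simp add: initialize_def)
  moreover have "\<mu> r = Some (ISS 0 z (take (?k - r) w))" if "r \<le> ?k" for r
  proof (cases "r = ?k")
    case False
    then have "r < ?k" "take (?k - r) w \<noteq> []" using that by auto
    then show ?thesis using P by (simp add: P_def ISS_0 del: take_eq_Nil)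
  qed (use P in \<open>simp add: P_def ISS_Nil\<close>)
  ultimately show ?thesis using P by (auto simp: P_def)
qed

text \<open>The bound on \<open>i\<close> keeps the scratch cell distinct from cells
  \<open>i\<close> and \<open>Suc i\<close>, and makes \<open>k - i\<close> a valid letter number,
  found at list position \<open>k - Suc i\<close>. The value \<open>u\<close> left in the scratch
  cell is unspecified, since the next evaluation overwrites it.\<close>

lemma exec_update_cell:
  assumes "\<sigma> ''j'' \<in> {1..T}" "\<sigma> ''i'' = i" "i < length w"
    and "\<mu> i = Some x" "\<mu> (Suc i) = Some y"
  shows "\<exists>u. exec T z w update_cell (\<sigma>, \<mu>) 3 (\<sigma>(''i'' := Suc i), \<mu>(Suc (length w) \<mapsto> u,
    i \<mapsto> x + y * letter_eval (z (\<sigma> ''j'')) (w ! (length w - Suc i))))"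
proof -
  let ?k = "length w"
  define v where "v = letter_eval (z (\<sigma> ''j'')) (w ! (?k - Suc i))"
  have 1: "exec T z w
      (Eval_Letter (Plus Word_Length (Num 1)) (Var ''j'') (Minus Word_Length (Var ''i'')))
      (\<sigma>, \<mu>) 1 (\<sigma>, \<mu>(Suc ?k \<mapsto> v))"
    using exec_Eval_Letter[of T w \<sigma> "Var ''j''" "Minus Word_Length (Var ''i'')" z
        "Plus Word_Length (Num 1)" \<mu>] assms
    by (auto simp: v_def)
  have 2: "exec T z w
      (Mult (Plus Word_Length (Num 1)) (Plus (Var ''i'') (Num 1)) (Plus Word_Length (Num 1)))
      (\<sigma>, \<mu>(Suc ?k \<mapsto> v)) 1 (\<sigma>, \<mu>(Suc ?k \<mapsto> y * v))"
    using exec_Mult[of "\<mu>(Suc ?k \<mapsto> v)" T w \<sigma> "Plus (Var ''i'') (Num 1)" y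
        "Plus Word_Length (Num 1)" v z "Plus Word_Length (Num 1)"] assms
    by auto
  have 3: "exec T z w (Add (Var ''i'') (Var ''i'') (Plus Word_Length (Num 1)))
      (\<sigma>, \<mu>(Suc ?k \<mapsto> y * v)) 1 (\<sigma>, \<mu>(Suc ?k \<mapsto> y * v, i \<mapsto> x + y * v))"
    using exec_Add[of "\<mu>(Suc ?k \<mapsto> y * v)" T w \<sigma> "Var ''i''" x
        "Plus Word_Length (Num 1)" "y * v" z "Var ''i''"] assms
    by auto
  have 4: "exec T z w (Assign ''i'' (Plus (Var ''i'') (Num 1))) (\<sigma>, \<mu>') 0 (\<sigma>(''i'' := Suc i), \<mu>')"
    for \<mu>'
    using exec_Assign[of T z w "''i''" "Plus (Var ''i'') (Num 1)" \<sigma> \<mu>'] assms by simp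
  have "exec T z w update_cell (\<sigma>, \<mu>) (1 + (1 + (1 + 0)))
      (\<sigma>(''i'' := Suc i), \<mu>(Suc ?k \<mapsto> y * v, i \<mapsto> x + y * v))"
    unfolding update_cell_def by (intro exec_Seq) (rule 1 2 3 4)+
  then show ?thesis unfolding v_def by (intro exI[of _ "y * v"]) (simp add: numeral_3_eq_3 v_def)
qed

lemma exec_sweep:
  fixes z :: "nat \<Rightarrow> 's::{comm_semiring_0, comm_monoid_mult} ^ 'd"
  assumes "\<sigma> ''j'' = j" "j < T"
    and "\<And>r. r \<le> length w \<Longrightarrow> \<mu> r = Some (ISS j z (take (length w - r) w))"
    and "dom \<mu> \<subseteq> {..Suc (length w)}"
  shows "\<exists>\<sigma>' \<mu>'. exec T z w sweep (\<sigma>, \<mu>) (length w * 3) (\<sigma>', \<mu>') \<and> \<sigma>' ''j'' = Suc j \<and>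
     (\<forall>r\<le>length w. \<mu>' r = Some (ISS (Suc j) z (take (length w - r) w))) \<and>
     dom \<mu>' \<subseteq> {..Suc (length w)}"
proof -
  let ?k = "length w"
  \<comment> \<open>During a sweep the column is mixed: cells below \<open>i\<close> have reached
    time \<open>Suc j\<close>, the others are still at time \<open>j\<close>. In particular cell
    \<open>Suc i\<close> supplies the old value that the recursion asks for.\<close>
  define P where "P i s \<longleftrightarrow> fst s ''i'' = i \<and> fst s ''j'' = Suc j \<and>
    (\<forall>r\<le>?k. snd s r = Some (ISS (if r < i then Suc j else j) z (take (?k - r) w))) \<and>
    dom (snd s) \<subseteq> {..Suc ?k}"
    for i and s :: "istore \<times> 's cells"
  let ?\<sigma> = "\<sigma>(''j'' := Suc j, ''i'' := 0)"
  have "\<exists>t. exec T z w (While (Less (Var ''i'') Word_Length) update_cell) (?\<sigma>, \<mu>) (?k * 3) t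
      \<and> P ?k t"
  proof (rule exec_counting_loop)
    fix i and s :: "istore \<times> 's cells"
    assume i: "i < ?k" and P: "P i s"
    obtain \<sigma>1 \<mu>1 where s: "s = (\<sigma>1, \<mu>1)" by fastforce
    \<comment> \<open>Cell \<open>i\<close> belongs to the prefix of length \<open>Suc p\<close> and
      cell \<open>Suc i\<close> to that of length \<open>p\<close>, which matches the recursion at
      the letter \<open>w ! p\<close>.\<close>
    define p where "p = ?k - Suc i"
    have p: "?k - i = Suc p" "p < ?k" using i by (auto simp: p_def)
    have st: "\<sigma>1 ''i'' = i" "\<sigma>1 ''j'' = Suc j" "dom \<mu>1 \<subseteq> {..Suc ?k}"
      and cell: "\<And>r. r \<le> ?k \<Longrightarrow>
        \<mu>1 r = Some (ISS (if r < i then Suc j else j) z (take (?k - r) w))"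
      using P unfolding P_def s by simp_all
    have cell_i: "\<mu>1 i = Some (ISS j z (take (Suc p) w))" using cell[of i] i p(1) by simp
    have cell_Suc_i: "\<mu>1 (Suc i) = Some (ISS j z (take p w))"
      using cell[of "Suc i"] i unfolding p_def by simp
    have "\<sigma>1 ''j'' \<in> {1..T}" using st(2) assms(2) by simp
    from exec_update_cell[OF this st(1) i cell_i cell_Suc_i, of z]
    obtain u where ex: "exec T z w update_cell (\<sigma>1, \<mu>1) 3 (\<sigma>1(''i'' := Suc i),
        \<mu>1(Suc ?k \<mapsto> u, i \<mapsto> ISS (Suc j) z (take (Suc p) w)))"
      unfolding ISS_Suc_take[OF p(2)] p_def[symmetric] st(2) by blast
    have "(\<mu>1(Suc ?k \<mapsto> u, i \<mapsto> ISS (Suc j) z (take (Suc p) w))) r =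
        Some (ISS (if r < Suc i then Suc j else j) z (take (?k - r) w))" if "r \<le> ?k" for r
    proof (cases "r = i")
      case True
      then show ?thesis using p(1) by simp
    next
      case False
      then have "r < Suc i \<longleftrightarrow> r < i" by arith
      then show ?thesis using cell[OF that] that False by simp
    qed
    moreover have "dom (\<mu>1(Suc ?k \<mapsto> u, i \<mapsto> ISS (Suc j) z (take (Suc p) w))) \<subseteq> {..Suc ?k}"
      using st(3) i by simp
    ultimately have "P (Suc i) (\<sigma>1(''i'' := Suc i),
        \<mu>1(Suc ?k \<mapsto> u, i \<mapsto> ISS (Suc j) z (take (Suc p) w)))"
      using st(2) unfolding P_def by simp
    then show "\<exists>t. exec T z w update_cell s 3 t \<and> P (Suc i) t" using ex s by blast
  qed (use assms in \<open>auto simp: P_def\<close>)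
  then obtain \<sigma>' \<mu>' where
    loop: "exec T z w (While (Less (Var ''i'') Word_Length) update_cell) (?\<sigma>, \<mu>) (?k * 3) (\<sigma>', \<mu>')"
    and P: "P ?k (\<sigma>', \<mu>')" by auto
  have set_j: "exec T z w (Assign ''j'' (Plus (Var ''j'') (Num 1))) (\<sigma>, \<mu>) 0 (\<sigma>(''j'' := Suc j), \<mu>)"
    using exec_Assign[of T z w "''j''" "Plus (Var ''j'') (Num 1)" \<sigma> \<mu>] assms(1) by simp
  have set_i: "exec T z w (Assign ''i'' (Num 0)) (\<sigma>(''j'' := Suc j), \<mu>) 0 (?\<sigma>, \<mu>)"
    using exec_Assign[of T z w "''i''" "Num 0" "\<sigma>(''j'' := Suc j)" \<mu>] by simp
  have "exec T z w sweep (\<sigma>, \<mu>) (0 + (0 + ?k * 3)) (\<sigma>', \<mu>')"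
    unfolding sweep_def by (rule exec_Seq[OF set_j exec_Seq[OF set_i loop]])
  \<comment> \<open>The final invariant still puts cell \<open>?k\<close> at time \<open>j\<close>;
    this is harmless because the coefficient of the empty prefix does not depend on time.\<close>
  moreover have "\<mu>' r = Some (ISS (Suc j) z (take (?k - r) w))" if "r \<le> ?k" for r
    using P that by (cases "r = ?k") (simp_all add: P_def ISS_Nil)
  ultimately show ?thesis
    using P by (intro exI[of _ \<sigma>'] exI[of _ \<mu>']) (simp add: P_def)
qed

text \<open>The cost comes from \<open>T\<close> sweeps of \<open>length w\<close> updates with
  three operations each. Storage is bounded by the addresses in use, which run from 0 to the scratch
  cell \<open>length w + 1\<close>.\<close>

lemma exec_iss_program:
  fixes z :: "nat \<Rightarrow> 's::{comm_semiring_0, comm_monoid_mult} ^ 'd"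
  shows "\<exists>s. exec T z w iss_program init_state (T * (length w * 3)) s \<and>
     result s = Some (ISS T z w) \<and> storage s \<le> length w + 2"
proof -
  let ?k = "length w"
  define P where "P j s \<longleftrightarrow> fst s ''j'' = j \<and>
    (\<forall>r\<le>?k. snd s r = Some (ISS j z (take (?k - r) w))) \<and> dom (snd s) \<subseteq> {..Suc ?k}"
    for j and s :: "istore \<times> 's cells"
  obtain s0 where s0: "exec T z w initialize init_state 0 s0" "P 0 s0"
    using exec_initialize[of T z w] by (auto simp: P_def)
  have "\<exists>t. exec T z w (While (Less (Var ''j'') Series_Length) sweep) s0 (T * (?k * 3)) t \<and> P T t"
  proof (rule exec_counting_loop)
    fix j and s :: "istore \<times> 's cells"
    assume j: "j < T" and P: "P j s"
    obtain \<sigma> \<mu> where s: "s = (\<sigma>, \<mu>)" by fastforce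
    show "\<exists>t. exec T z w sweep s (?k * 3) t \<and> P (Suc j) t"
      using exec_sweep[of \<sigma> j T w \<mu> z] P j s by (auto simp: P_def)
  qed (use s0 in \<open>auto simp: P_def\<close>)
  then obtain s where s: "exec T z w (While (Less (Var ''j'') Series_Length) sweep) s0 (T * (?k * 3)) s"
    "P T s" by blast
  have "card (dom (snd s)) \<le> card {..Suc ?k}"
    using s(2) by (intro card_mono) (auto simp: P_def)
  then have "storage s \<le> ?k + 2" by (simp add: storage_def)
  moreover have "result s = Some (ISS T z w)" using s(2) by (auto simp: P_def result_def)
  moreover have "exec T z w iss_program init_state (T * (?k * 3)) s"
    unfolding iss_program_def using exec_Seq[OF s0(1) s(1)] by simp
  ultimately show ?thesis by blast
qed

theorem mainTheorem7:
  "\<exists>(c :: com) (C :: nat).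
     \<forall>(T :: nat) (z :: nat \<Rightarrow> 's::{comm_semiring_0, comm_monoid_mult} ^ 'd::finite)
       (w :: 'd letter list).
       T \<ge> 1 \<longrightarrow> w \<in> lists alphabet \<longrightarrow> length w \<ge> 1 \<longrightarrow>
       (\<exists>n s. exec T z w c init_state n s \<and>
              result s = Some (ISS T z w) \<and>
              n \<le> C * (T * length w) \<and>
              storage s \<le> C * (T * length w))"
\<comment> \<open>The constant 3 is the number of operations per update. It also serves for storage:
  \<open>k + 2\<close> is at most \<open>3 * k\<close> as \<open>k\<close> is at least 1, and a
  factor \<open>T\<close> of at least 1 only enlarges the bound.\<close>
proof (rule exI[of _ iss_program], rule exI[of _ 3], intro allI impI)
  fix T :: nat and z :: "nat \<Rightarrow> 's::{comm_semiring_0, comm_monoid_mult} ^ 'd::finite" and w :: "'d letter list"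
  assume "T \<ge> 1" "length w \<ge> 1"
  then have "length w + 2 \<le> 3 * length w" "length w \<le> T * length w" by auto
  then have "length w + 2 \<le> 3 * (T * length w)" by linarith
  moreover obtain s where "exec T z w iss_program init_state (T * (length w * 3)) s"
    "result s = Some (ISS T z w)" "storage s \<le> length w + 2"
    using exec_iss_program by blast
  ultimately show "\<exists>n s. exec T z w iss_program init_state n s \<and> result s = Some (ISS T z w) \<and>
      n \<le> 3 * (T * length w) \<and> storage s \<le> 3 * (T * length w)"
    by (intro exI[of _ "T * (length w * 3)"] exI[of _ s]) simp
qed

end
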